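(* Let $T=(Q,A,B,\longrightarrow,O,H)$ be a finite, non-blocking alternating transition system, $\phi$ an LTL$_{-X}(\mathbb{P})$ formula, and $\Pi:Q\to 2^{\mathbb{P}}$ a valuation function. If the control strategy algorithm, run on input $(T,\phi,\Pi)$, returns a state $q_0$ and a control strategy $f_{RP}$, then $\sigma\models\phi$ for every $\sigma\in Out(q_0,f_{RP})$.
   Context: $\mathbb{N}$ is the set of positive integers; $X^{+}$ and $X^{\omega}$ are the sets of non-empty finite strings and of infinite strings over $X$; $s[i]$ is the $i$-th letter of $s$, $s[1,i]$ its prefix of length $i$, $s[end]$ the last letter, $|s|$ the length. Alternating transition system: a tuple $T=(Q,A,B,\longrightarrow,O,H)$ with states $Q$, control labels $A$, disturbance labels $B$, transition relation $\longrightarrow\subseteq Q\times A\times B\times Q$ (written $q\xrightarrow{a,b}q'$), observation set $O$ and observation function $H:Q\to O$. Finite: $Q,A,B$ are finite. Non-blocking: $\{q':q\xrightarrow{a,b}q'\}\neq\emptyset$ for all $q\in Q,a\in A,b\in B$. LTL$_{-X}(\mathbb{P})$ over a finite set $\mathbb{P}$ of atomic propositions: $\varphi::=p\mid\neg\varphi\mid\varphi_1\wedge\varphi_2\mid\varphi_1\mathbf{U}\varphi_2$ with $p\in\mathbb{P}$. For $w\in(2^{\mathbb{P}})^{\omega}$ and $i\in\mathbb{N}$: $w[i]\models p$ iff $p\in w[i]$; $\neg,\wedge$ as usual; $w[i]\models\varphi_1\mathbf{U}\varphi_2$ iff there is $j\ge i$ with $w[j]\models\varphi_2$ and $w[k]\models\varphi_1$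 for all $i\le k<j$. $w\models\varphi$ iff $w[1]\models\varphi$. For $\sigma\in Q^{\omega}$ and $\Pi:Q\to2^{\mathbb{P}}$, $\sigma\models\varphi$ means $\Pi(\sigma[1])\Pi(\sigma[2])\cdots\models\varphi$. A control strategy of $T$ is any function $f:Q^{+}\to A$. $Out(q,f)$ is the set of $\sigma\in Q^{\omega}$ with $\sigma[1]=q$ such that for all $i\in\mathbb{N}$ there is $b_i\in B$ with $\sigma[i]\xrightarrow{f(\sigma[1,i]),b_i}\sigma[i+1]$. Reactive agent $(q_0,succ_T)$ of $T$: for $q\in Q$, executing action $a\in A$ in world state $q$ has the set of possible successors $\{q'\in Q: q\xrightarrow{a,b}q'\text{ for some }b\in B\}$ (every action has duration 1). A reactive plan of $(q_0,succ_T)$ is a finite set $RP=\{(1,q_1,a_1,N_1),\dots,(k,q_k,a_k,N_k)\}$ where $1,\dots,k$ are plan states, plan state $i$ is labelled by world state $q_i\in Q$, $q_1=q_0$, $a_i\in A$ is the action executed in $i$, and $N_i\subseteq\{1,\dots,k\}$ is a set of successor plan states: the label $q_j$ of each $j\in N_i$ is a successor of $q_i$ under $a_i$, and for each successor $q'$ of $q_i$ under $a_i$ there is $j\in N_i$ with $q_j=q'$. A trajectory generated by $RP$ is $\sigma\in Q^{\omega}$ for which there is $i_1i_2\cdots\in\{1,\dots,k\}^{\omega}$ with $i_1=1$, $i_{j+1}\in N_{i_j}$ and $q_{i_j}=\sigma[j]$ for all $j\in\mathbb{N}$. $RP$ satisfies $\phi$ (w.r.t. $\Pi$) iff it generates at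 least one trajectory and all trajectories it generates satisfy $\phi$. Planner (Kabanza et al.'s planning algorithm, a known procedure): on input $(q_0,succ_T)$, $\phi$, $\Pi$ it returns either a reactive plan of $(q_0,succ_T)$ or failure; any returned plan satisfies $\phi$, and a plan is returned whenever one satisfying $\phi$ exists. A path of $RP$ is $s\in\{1,\dots,k\}^{+}$ with $|s|>1$ and $s[i+1]\in N_{s[i]}$ for all $i<|s|$. Simplification of $RP$: going through $i=1,2,\dots,k$, take the first $i$ for which there exist a path from $i$ to $i$ and a path from $1$ to $i$; let $suffix$ be a shortest path from $i$ to $i$ and $prefix$ a shortest path from $1$ to $i$ (if no such $i$ exists, only rule (c) below is used). Then for every plan state $i$ and every maximal family of $m>1$ elements $j_1,\dots,j_m\in N_i$ with $q_{j_1}=\dots=q_{j_m}$, keep exactly one of them in $N_i$ and remove the others: (a) if for some $l$ there is $n<|prefix|$ with $i=prefix[n]$, $j_l=prefix[n+1]$, keep $j_l$; (b) otherwise, if for some $l$ there is $n<|suffix|$ with $i=suffix[n]$, $j_l=suffix[n+1]$, keep $j_l$; (c) otherwise keep $j_1$. Strategy generated by a plan: if $RP$ is such that for every $i$ and every $q\in Q$ at most one $j\in N_i$ has $q_j=q$, then $f_{RP}:Q^{+}\to A$ is defined by: $f_{RP}(s)=a_{s_N[end]}$ if there is $s_N\in\{1,\dots,k\}^{+}$ with $|s_N|=|s|$, $s_N[1]=1$, $s_N[j+1]\in N_{s_N[j]}$ for $j<|s|$ and $s[j]=q_{s_N[j]}$ for all $j\le|s|$ (such $s_N$ is then unique); otherwise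 $f_{RP}(s)=a_1$. Control strategy algorithm, input $(T,\phi,\Pi)$: for each $q_0\in Q$ in turn, call the planner on $(q_0,succ_T),\phi,\Pi$; if a plan $RP_{kab}$ is found, let $RP$ be its simplification and return $q_0$ and $f_{RP}$. If no $q_0$ succeeds, return false. *)

theory Defs
  imports "HOL-Library.Omega_Words_Fun"
begin

(* Infinite strings are omega-words "'x word", i.e. functions on nat. Their positions start
   at 0, so the letter s[i] of the text is "s (i - 1)" here, and the prefix s[1,i] is
   "prefix i s". Likewise the letter s[i] of a finite string is "s ! (i - 1)". *)

section \<open>Alternating transition systems\<close>

record ('q, 'a, 'b, 'o) ats =
  states :: "'q set"
  controls :: "'a set"
  disturbances :: "'b set"
  trans :: "('q \<times> 'a \<times> 'b \<times> 'q) set"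
  observations :: "'o set"
  observe :: "'q \<Rightarrow> 'o"

definition ats :: "('q, 'a, 'b, 'o) ats \<Rightarrow> bool" where
  "ats T \<longleftrightarrow>
     trans T \<subseteq> states T \<times> controls T \<times> disturbances T \<times> states T \<and>
     observe T ` states T \<subseteq> observations T"

definition finite_ats :: "('q, 'a, 'b, 'o) ats \<Rightarrow> bool" where
  "finite_ats T \<longleftrightarrow> finite (states T) \<and> finite (controls T) \<and> finite (disturbances T)"

definition non_blocking :: "('q, 'a, 'b, 'o) ats \<Rightarrow> bool" where
  "non_blocking T \<longleftrightarrow>
     (\<forall>q\<in>states T. \<forall>a\<in>controls T. \<forall>b\<in>disturbances T. {q'. (q, a, b, q') \<in> trans T} \<noteq> {})"

definition Out :: "('q, 'a, 'b, 'o) ats \<Rightarrow> 'q \<Rightarrow> ('q list \<Rightarrow> 'a) \<Rightarrow> 'q word set" where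
  "Out T q f = {\<sigma>. range \<sigma> \<subseteq> states T \<and> \<sigma> 0 = q \<and>
     (\<forall>i. \<exists>b\<in>disturbances T. (\<sigma> i, f (prefix (Suc i) \<sigma>), b, \<sigma> (Suc i)) \<in> trans T)}"


section \<open>Linear temporal logic without the next operator\<close>

datatype (atoms: 'p) ltl =
    Prop 'p
  | Neg "'p ltl"
  | Conj "'p ltl" "'p ltl"
  | Until "'p ltl" "'p ltl"

primrec sat_at :: "'p set word \<Rightarrow> nat \<Rightarrow> 'p ltl \<Rightarrow> bool" where
  "sat_at w i (Prop p) \<longleftrightarrow> p \<in> w i"
| "sat_at w i (Neg \<phi>) \<longleftrightarrow> \<not> sat_at w i \<phi>"
| "sat_at w i (Conj \<phi> \<psi>) \<longleftrightarrow> sat_at w i \<phi> \<and> sat_at w i \<psi>"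
| "sat_at w i (Until \<phi> \<psi>) \<longleftrightarrow>
     (\<exists>j\<ge>i. sat_at w j \<psi> \<and> (\<forall>k. i \<le> k \<and> k < j \<longrightarrow> sat_at w k \<phi>))"

definition models :: "('q \<Rightarrow> 'p set) \<Rightarrow> 'q word \<Rightarrow> 'p ltl \<Rightarrow> bool" where
  "models \<Pi> \<sigma> \<phi> \<longleftrightarrow> sat_at (\<Pi> \<circ> \<sigma>) 0 \<phi>"


section \<open>Reactive agents and plans\<close>

(* The pair (q0, succ) with the sets of world states and of actions, which "succ" has as its
   domain, made explicit. *)
record ('q, 'a) agent =
  initial :: 'q
  world :: "'q set"
  actions :: "'a set"
  successors :: "'q \<Rightarrow> 'a \<Rightarrow> 'q set"

definition agent_of :: "('q, 'a, 'b, 'o) ats \<Rightarrow> 'q \<Rightarrow> ('q, 'a) agent" where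
  "agent_of T q\<^sub>0 =
     \<lparr>initial = q\<^sub>0, world = states T, actions = controls T,
      successors = (\<lambda>q a. {q' \<in> states T. \<exists>b\<in>disturbances T. (q, a, b, q') \<in> trans T})\<rparr>"

(* The plan {(1, q_1, a_1, N_1), ..., (k, q_k, a_k, N_k)}: the functions "label" (q_i),
   "act" (a_i) and "nexts" (N_i) are only meaningful on the plan states 1, ..., k. *)
record ('q, 'a) plan =
  plan_size :: nat
  label :: "nat \<Rightarrow> 'q"
  act :: "nat \<Rightarrow> 'a"
  nexts :: "nat \<Rightarrow> nat set"

definition plan_states :: "('q, 'a) plan \<Rightarrow> nat set" where
  "plan_states RP = {1..plan_size RP}"

definition reactive_plan :: "('q, 'a) agent \<Rightarrow> ('q, 'a) plan \<Rightarrow> bool" where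
  "reactive_plan G RP \<longleftrightarrow>
     1 \<in> plan_states RP \<and> label RP 1 = initial G \<and>
     (\<forall>i\<in>plan_states RP.
        label RP i \<in> world G \<and> act RP i \<in> actions G \<and> nexts RP i \<subseteq> plan_states RP \<and>
        (\<forall>j\<in>nexts RP i. label RP j \<in> successors G (label RP i) (act RP i)) \<and>
        (\<forall>q'\<in>successors G (label RP i) (act RP i). \<exists>j\<in>nexts RP i. label RP j = q'))"

definition trajectories :: "('q, 'a) plan \<Rightarrow> 'q word set" where
  "trajectories RP = {\<sigma>. \<exists>r :: nat word. range r \<subseteq> plan_states RP \<and> r 0 = 1 \<and>
     (\<forall>j. r (Suc j) \<in> nexts RP (r j) \<and> label RP (r j) = \<sigma> j)}"

definition plan_satisfies :: "('q \<Rightarrow> 'p set) \<Rightarrow> ('q, 'a) plan \<Rightarrow> 'p ltl \<Rightarrow> bool" where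
  "plan_satisfies \<Pi> RP \<phi> \<longleftrightarrow>
     trajectories RP \<noteq> {} \<and> (\<forall>\<sigma>\<in>trajectories RP. models \<Pi> \<sigma> \<phi>)"


section \<open>The planner\<close>

type_synonym ('q, 'a, 'p) planner =
  "('q, 'a) agent \<Rightarrow> 'p ltl \<Rightarrow> ('q \<Rightarrow> 'p set) \<Rightarrow> ('q, 'a) plan option"

(* The input/output specification of the planner on the agents of T; "None" is failure. *)
definition correct_planner ::
  "('q, 'a, 'b, 'o) ats \<Rightarrow> 'p set \<Rightarrow> ('q, 'a, 'p) planner \<Rightarrow> bool" where
  "correct_planner T P planner \<longleftrightarrow>
     (\<forall>q\<^sub>0\<in>states T. \<forall>\<phi> \<Pi>. atoms \<phi> \<subseteq> P \<and> \<Pi> ` states T \<subseteq> Pow P \<longrightarrow>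
        (\<forall>RP. planner (agent_of T q\<^sub>0) \<phi> \<Pi> = Some RP \<longrightarrow>
           reactive_plan (agent_of T q\<^sub>0) RP \<and> plan_satisfies \<Pi> RP \<phi>) \<and>
        ((\<exists>RP. reactive_plan (agent_of T q\<^sub>0) RP \<and> plan_satisfies \<Pi> RP \<phi>) \<longrightarrow>
           planner (agent_of T q\<^sub>0) \<phi> \<Pi> \<noteq> None))"


section \<open>Simplification of plans\<close>

(* A path has at least one step, so a path from a state to itself is a cycle. *)
definition path :: "('q, 'a) plan \<Rightarrow> nat \<Rightarrow> nat \<Rightarrow> nat list \<Rightarrow> bool" where
  "path RP u v s \<longleftrightarrow> length s > 1 \<and> set s \<subseteq> plan_states RP \<and>
     (\<forall>n. Suc n < length s \<longrightarrow> s ! Suc n \<in> nexts RP (s ! n)) \<and> hd s = u \<and> last s = v"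

definition shortest_path :: "('q, 'a) plan \<Rightarrow> nat \<Rightarrow> nat \<Rightarrow> nat list \<Rightarrow> bool" where
  "shortest_path RP u v s \<longleftrightarrow>
     path RP u v s \<and> (\<forall>s'. path RP u v s' \<longrightarrow> length s \<le> length s')"

definition lasso_state :: "('q, 'a) plan \<Rightarrow> nat \<Rightarrow> bool" where
  "lasso_state RP i \<longleftrightarrow> i \<in> plan_states RP \<and> (\<exists>s. path RP i i s) \<and> (\<exists>s. path RP 1 i s)"

(* If there is no state to close a lasso, both strings are empty; then "consecutive" below never
   holds for them and rules (a) and (b) do not apply. *)
definition lasso :: "('q, 'a) plan \<Rightarrow> nat list \<Rightarrow> nat list \<Rightarrow> bool" where
  "lasso RP pre suf \<longleftrightarrow>
     (if \<exists>i. lasso_state RP i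
      then \<exists>i. lasso_state RP i \<and> (\<forall>i'<i. \<not> lasso_state RP i') \<and>
               shortest_path RP i i suf \<and> shortest_path RP 1 i pre
      else pre = [] \<and> suf = [])"

definition consecutive :: "nat list \<Rightarrow> nat \<Rightarrow> nat \<Rightarrow> bool" where
  "consecutive s i j \<longleftrightarrow> (\<exists>n. Suc n < length s \<and> i = s ! n \<and> j = s ! Suc n)"

definition family :: "('q, 'a) plan \<Rightarrow> nat \<Rightarrow> 'q \<Rightarrow> nat set" where
  "family RP i q = {j \<in> nexts RP i. label RP j = q}"

(* Rules (a), (b) and (c). The members of a family come in no particular order, so in case (c)
   any of them may be the first one. *)
definition may_keep :: "nat list \<Rightarrow> nat list \<Rightarrow> nat \<Rightarrow> nat set \<Rightarrow> nat \<Rightarrow> bool" where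
  "may_keep pre suf i J j \<longleftrightarrow> j \<in> J \<and>
     (if \<exists>l\<in>J. consecutive pre i l then consecutive pre i j
      else if \<exists>l\<in>J. consecutive suf i l then consecutive suf i j
      else True)"

(* A relation, because the shortest paths and the order of a family are not unique. *)
definition simplification :: "('q, 'a) plan \<Rightarrow> ('q, 'a) plan \<Rightarrow> bool" where
  "simplification RP RP' \<longleftrightarrow> (\<exists>pre suf N. lasso RP pre suf \<and> RP' = RP\<lparr>nexts := N\<rparr> \<and>
     (\<forall>i\<in>plan_states RP. \<forall>q.
        if card (family RP i q) > 1
        then \<exists>j. may_keep pre suf i (family RP i q) j \<and> family RP' i q = {j}
        else family RP' i q = family RP i q))"


section \<open>The control strategy algorithm\<close>

definition plan_run :: "('q, 'a) plan \<Rightarrow> 'q list \<Rightarrow> nat list \<Rightarrow> bool" where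
  "plan_run RP s r \<longleftrightarrow> r \<noteq> [] \<and> set r \<subseteq> plan_states RP \<and> length r = length s \<and> r ! 0 = 1 \<and>
     (\<forall>j. Suc j < length s \<longrightarrow> r ! Suc j \<in> nexts RP (r ! j)) \<and>
     (\<forall>j < length s. s ! j = label RP (r ! j))"

(* Meaningful for plans in which every family has at most one member, so that the run is unique. *)
definition plan_strategy :: "('q, 'a) plan \<Rightarrow> 'q list \<Rightarrow> 'a" where
  "plan_strategy RP s =
     (if \<exists>r. plan_run RP s r then act RP (last (THE r. plan_run RP s r)) else act RP 1)"

inductive search ::
  "('q, 'a, 'p) planner \<Rightarrow> ('q, 'a, 'b, 'o) ats \<Rightarrow> 'p ltl \<Rightarrow> ('q \<Rightarrow> 'p set) \<Rightarrow>
   'q list \<Rightarrow> ('q \<times> ('q list \<Rightarrow> 'a)) option \<Rightarrow> bool"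
  for planner T \<phi> \<Pi> where
  exhausted: "search planner T \<phi> \<Pi> [] None"
| found: "planner (agent_of T q\<^sub>0) \<phi> \<Pi> = Some RP\<^sub>k\<^sub>a\<^sub>b \<Longrightarrow> simplification RP\<^sub>k\<^sub>a\<^sub>b RP \<Longrightarrow>
    search planner T \<phi> \<Pi> (q\<^sub>0 # qs) (Some (q\<^sub>0, plan_strategy RP))"
| failed: "planner (agent_of T q\<^sub>0) \<phi> \<Pi> = None \<Longrightarrow> search planner T \<phi> \<Pi> qs res \<Longrightarrow>
    search planner T \<phi> \<Pi> (q\<^sub>0 # qs) res"

(* The algorithm on input (T, \<phi>, \<Pi>) can return "res", where "None" stands for false. The order
   in which the states are tried is left open. *)
definition algorithm_returns ::
  "('q, 'a, 'p) planner \<Rightarrow> ('q, 'a, 'b, 'o) ats \<Rightarrow> 'p ltl \<Rightarrow> ('q \<Rightarrow> 'p set) \<Rightarrow>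
   ('q \<times> ('q list \<Rightarrow> 'a)) option \<Rightarrow> bool" where
  "algorithm_returns planner T \<phi> \<Pi> res \<longleftrightarrow>
     (\<exists>qs. distinct qs \<and> set qs = states T \<and> search planner T \<phi> \<Pi> qs res)"

end

(* The simplified plan is a reactive plan whose successor sets are contained in those of the
   planner's plan, so its trajectories satisfy the formula. Since no two successors of one of its
   plan states share a label, the run of the plan along any string of world states is unique.
   Hence the run along each prefix of an outcome of the plan strategy extends step by step, and the
   outcome is a trajectory. *)
theory Submission
  imports Defs
begin

text \<open>Each of the three rules keeps a member of the family itself, so a family may shrink but
  is never emptied.\<close>

lemma family_simplification:
  assumes "simplification RP RP'" and "i \<in> plan_states RP"
  shows "family RP' i q \<subseteq> family RP i q"
    and "family RP i q \<noteq> {} \<Longrightarrow> family RP' i q \<noteq> {}"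
    and "card (family RP' i q) \<le> 1"
proof -
  obtain pre suf where *:
    "if card (family RP i q) > 1
     then \<exists>j. may_keep pre suf i (family RP i q) j \<and> family RP' i q = {j}
     else family RP' i q = family RP i q"
    using assms unfolding simplification_def by blast
  then show "family RP' i q \<subseteq> family RP i q"
    and "family RP i q \<noteq> {} \<Longrightarrow> family RP' i q \<noteq> {}"
    and "card (family RP' i q) \<le> 1"
    by (auto simp: may_keep_def split: if_splits)
qed

lemma simplification_simps:
  assumes "simplification RP RP'"
  shows "plan_states RP' = plan_states RP" "label RP' = label RP" "act RP' = act RP"
  using assms by (auto simp: simplification_def plan_states_def)

lemma nexts_simplification:
  assumes "simplification RP RP'" and "i \<in> plan_states RP"
  shows "nexts RP' i \<subseteq> nexts RP i"
  using family_simplification(1)[OF assms] simplification_simps(2)[OF assms(1)]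
  unfolding family_def by auto

text \<open>Deleting successors can only endanger the clause that every world successor is the label
  of some plan successor. It survives because no family is emptied.\<close>

lemma reactive_plan_simplification:
  assumes simp: "simplification RP RP'" and plan: "reactive_plan G RP"
  shows "reactive_plan G RP'"
proof -
  have "\<exists>j\<in>nexts RP' i. label RP j = q'"
    if i: "i \<in> plan_states RP" and "q' \<in> successors G (label RP i) (act RP i)" for i q'
  proof -
    have "family RP i q' \<noteq> {}"
      using plan that by (fastforce simp: reactive_plan_def family_def)
    then have "family RP' i q' \<noteq> {}"
      by (rule family_simplification(2)[OF simp i])
    then show ?thesis
      by (auto simp: family_def simplification_simps[OF simp])
  qed
  moreover have "nexts RP' i \<subseteq> nexts RP i" if "i \<in> plan_states RP" for i
    using nexts_simplification[OF simp that] .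
  ultimately show ?thesis
    using plan unfolding reactive_plan_def simplification_simps[OF simp] by blast
qed

text \<open>Two plan successors with equal labels lie in one family. This determinism is what makes
  \<open>plan_strategy\<close> meaningful for the simplified plan.\<close>

lemma inj_on_label_simplification:
  assumes simp: "simplification RP RP'" and plan: "reactive_plan G RP"
    and i: "i \<in> plan_states RP"
  shows "inj_on (label RP') (nexts RP' i)"
proof (rule inj_onI)
  fix j j'
  assume j: "j \<in> nexts RP' i" "j' \<in> nexts RP' i" "label RP' j = label RP' j'"
  \<comment> \<open>Since \<open>card\<close> is 0 on infinite sets, the bound on
    \<open>card\<close> gives uniqueness only for finite families. Finiteness comes from the
    finitely many plan states.\<close>
  have "nexts RP' i \<subseteq> plan_states RP"
    using nexts_simplification[OF simp i] plan i unfolding reactive_plan_def by blast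
  then have "finite (nexts RP' i)"
    by (auto simp: plan_states_def intro: finite_subset)
  then have "finite (family RP' i (label RP' j))"
    by (simp add: family_def)
  moreover have "card (family RP' i (label RP' j)) \<le> 1"
    by (rule family_simplification(3)[OF simp i])
  moreover have "j \<in> family RP' i (label RP' j)" "j' \<in> family RP' i (label RP' j)"
    using j by (auto simp: family_def)
  ultimately show "j = j'"
    by (metis One_nat_def card_le_Suc0_iff_eq)
qed

lemma trajectories_simplification:
  assumes "simplification RP RP'"
  shows "trajectories RP' \<subseteq> trajectories RP"
proof
  fix \<sigma>
  assume "\<sigma> \<in> trajectories RP'"
  then obtain r where "range r \<subseteq> plan_states RP" "r 0 = 1"
    "\<forall>j. r (Suc j) \<in> nexts RP' (r j) \<and> label RP (r j) = \<sigma> j"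
    unfolding trajectories_def simplification_simps[OF assms] by auto
  moreover from this have "r (Suc j) \<in> nexts RP (r j)" for j
    using nexts_simplification[OF assms] by blast
  ultimately show "\<sigma> \<in> trajectories RP"
    unfolding trajectories_def by blast
qed

text \<open>Both runs start in 1. As long as they agree, their next states are taken from the same
  successor set and carry the same label, the next letter of \<open>s\<close>.\<close>

lemma plan_run_unique:
  assumes inj: "\<And>i. i \<in> plan_states RP \<Longrightarrow> inj_on (label RP) (nexts RP i)"
    and r: "plan_run RP s r" and r': "plan_run RP s r'"
  shows "r = r'"
proof (rule nth_equalityI)
  show "length r = length r'"
    using r r' by (simp add: plan_run_def)
  fix n
  assume "n < length r"
  then show "r ! n = r' ! n"
  proof (induction n)
    case 0
    then show ?case using r r' by (simp add: plan_run_def)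
  next
    case (Suc n)
    then have eq: "r ! n = r' ! n" and len: "Suc n < length s"
      using r by (auto simp: plan_run_def)
    have "r ! n \<in> plan_states RP"
      using r Suc.prems by (auto simp: plan_run_def)
    then have "inj_on (label RP) (nexts RP (r ! n))"
      by (rule inj)
    moreover have "r ! Suc n \<in> nexts RP (r ! n)" "r' ! Suc n \<in> nexts RP (r ! n)"
      using r r' len eq by (auto simp: plan_run_def)
    moreover have "label RP (r ! Suc n) = label RP (r' ! Suc n)"
      using r r' len unfolding plan_run_def by metis
    ultimately show ?case
      by (auto dest: inj_onD)
  qed
qed

lemma plan_run_snoc:
  assumes "plan_run RP s r" and "j \<in> nexts RP (last r)" and "j \<in> plan_states RP"
  shows "plan_run RP (s @ [label RP j]) (r @ [j])"
proof -
  have "(r @ [j]) ! Suc n \<in> nexts RP ((r @ [j]) ! n)" if "Suc n < length (s @ [label RP j])" for n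
  proof (cases "Suc n < length s")
    \<comment> \<open>Here \<open>n\<close> is the last index of \<open>r\<close>, so the step in
      question is the appended one from \<open>last r\<close> to \<open>j\<close>.\<close>
    case False
    then have "length r = Suc n" and "r \<noteq> []"
      using that assms(1) by (auto simp: plan_run_def)
    then show ?thesis
      using assms(2) by (simp add: last_conv_nth nth_append)
  qed (use assms(1) in \<open>auto simp: plan_run_def nth_append\<close>)
  then show ?thesis
    using assms unfolding plan_run_def by (auto simp: nth_append less_Suc_eq)
qed

lemma plan_strategy_plan_run:
  assumes "\<And>i. i \<in> plan_states RP \<Longrightarrow> inj_on (label RP) (nexts RP i)" and "plan_run RP s r"
  shows "plan_strategy RP s = act RP (last r)"
proof -
  have "(THE r. plan_run RP s r) = r"
    using assms plan_run_unique by (intro the_equality) blast+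
  then show ?thesis
    using assms(2) by (auto simp: plan_strategy_def)
qed

text \<open>The strategy plays the action of the plan state reached so far, so every move of
  \<open>T\<close> leads to a world successor under that action, and the plan has a plan successor
  labelled by it.\<close>

lemma Out_plan_strategy:
  assumes plan: "reactive_plan (agent_of T q\<^sub>0) RP"
    and inj: "\<And>i. i \<in> plan_states RP \<Longrightarrow> inj_on (label RP) (nexts RP i)"
  shows "Out T q\<^sub>0 (plan_strategy RP) \<subseteq> trajectories RP"
proof
  fix \<sigma>
  assume \<sigma>: "\<sigma> \<in> Out T q\<^sub>0 (plan_strategy RP)"
  \<comment> \<open>\<open>R n i\<close> says that the plan can be in state \<open>i\<close> after
    reading the letters of \<open>\<sigma>\<close> at positions 0 to \<open>n\<close>.\<close>
  define R where "R n i \<longleftrightarrow> (\<exists>r. plan_run RP (prefix (Suc n) \<sigma>) r \<and> last r = i)" for n i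
  have R: "i \<in> plan_states RP" "label RP i = \<sigma> n" if "R n i" for n i
  proof -
    obtain r where r: "plan_run RP (prefix (Suc n) \<sigma>) r" and i: "last r = i"
      using \<open>R n i\<close> by (auto simp: R_def)
    then show "i \<in> plan_states RP"
      by (auto simp: plan_run_def)
    have "r \<noteq> []" "length r = Suc n" "label RP (r ! n) = prefix (Suc n) \<sigma> ! n"
      using r by (auto simp: plan_run_def)
    then show "label RP i = \<sigma> n"
      using i by (simp add: last_conv_nth nth_append)
  qed
  have "R 0 1"
    using \<sigma> plan by (auto simp: R_def plan_run_def Out_def reactive_plan_def agent_of_def
        intro!: exI[of _ "[1]"])
  moreover have "\<exists>j. R (Suc n) j \<and> j \<in> nexts RP i" if "R n i" for n i
  proof -
    obtain r where r: "plan_run RP (prefix (Suc n) \<sigma>) r" and i: "last r = i"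
      using \<open>R n i\<close> by (auto simp: R_def)
    \<comment> \<open>Uniqueness of runs enters here: the strategy acts according to the run
      \<open>r\<close> at hand and not according to some other run along the same prefix.\<close>
    have "plan_strategy RP (prefix (Suc n) \<sigma>) = act RP i"
      using plan_strategy_plan_run[OF inj r] i by simp
    moreover have "\<sigma> (Suc n) \<in> states T" and
      "\<exists>b\<in>disturbances T. (\<sigma> n, plan_strategy RP (prefix (Suc n) \<sigma>), b, \<sigma> (Suc n)) \<in> trans T"
      using \<sigma> by (auto simp: Out_def)
    ultimately have "\<sigma> (Suc n) \<in> successors (agent_of T q\<^sub>0) (label RP i) (act RP i)"
      using R(2)[OF \<open>R n i\<close>] by (simp add: agent_of_def)
    then obtain j where j: "j \<in> nexts RP i" "label RP j = \<sigma> (Suc n)"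
      using plan R(1)[OF \<open>R n i\<close>] unfolding reactive_plan_def by blast
    moreover have "j \<in> plan_states RP"
      using j(1) plan R(1)[OF \<open>R n i\<close>] unfolding reactive_plan_def by blast
    ultimately have "plan_run RP (prefix (Suc (Suc n)) \<sigma>) (r @ [j])"
      using plan_run_snoc[OF r, of j] i by simp
    then show ?thesis
      using j(1) unfolding R_def by (metis last_snoc)
  qed
  \<comment> \<open>Dependent choice glues the one-step extensions into an infinite run. The
    conjunct for \<open>n = 0\<close> forces the chosen sequence to start in plan state 1.\<close>
  ultimately obtain r where r: "r 0 = 1" "\<And>n. R n (r n)" "\<And>n. r (Suc n) \<in> nexts RP (r n)"
    using dependent_nat_choice[of "\<lambda>n i. R n i \<and> (n = 0 \<longrightarrow> i = 1)" "\<lambda>_ i j. j \<in> nexts RP i"]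
    by auto
  then show "\<sigma> \<in> trajectories RP"
    using R unfolding trajectories_def by blast
qed

text \<open>Only the rule \<open>found\<close> creates a \<open>Some\<close>; \<open>failed\<close>
  passes on the result for the remaining states.\<close>

lemma search_SomeD:
  assumes "search planner T \<phi> \<Pi> qs (Some (q\<^sub>0, f))"
  shows "\<exists>RP RP'. q\<^sub>0 \<in> set qs \<and> planner (agent_of T q\<^sub>0) \<phi> \<Pi> = Some RP \<and>
    simplification RP RP' \<and> f = plan_strategy RP'"
  using assms by (induction qs "Some (q\<^sub>0, f)" rule: search.induct) auto

theorem theorem5p1:
  fixes T :: "('q, 'a, 'b, 'o) ats"
    and P :: "'p set" and \<phi> :: "'p ltl" and \<Pi> :: "'q \<Rightarrow> 'p set"
    and planner :: "('q, 'a, 'p) planner"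
    and q\<^sub>0 :: 'q and f\<^sub>R\<^sub>P :: "'q list \<Rightarrow> 'a"
  assumes "ats T" and "finite_ats T" and "non_blocking T"
    and "finite P" and "atoms \<phi> \<subseteq> P" and "\<Pi> ` states T \<subseteq> Pow P"
    and "correct_planner T P planner"
    and "algorithm_returns planner T \<phi> \<Pi> (Some (q\<^sub>0, f\<^sub>R\<^sub>P))"
  shows "\<forall>\<sigma>\<in>Out T q\<^sub>0 f\<^sub>R\<^sub>P. models \<Pi> \<sigma> \<phi>"
proof -
  obtain qs where "set qs = states T" "search planner T \<phi> \<Pi> qs (Some (q\<^sub>0, f\<^sub>R\<^sub>P))"
    using assms(8) unfolding algorithm_returns_def by blast
  then obtain RP RP' where "q\<^sub>0 \<in> states T" "planner (agent_of T q\<^sub>0) \<phi> \<Pi> = Some RP"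
    and simp: "simplification RP RP'" and f: "f\<^sub>R\<^sub>P = plan_strategy RP'"
    using search_SomeD by fast
  \<comment> \<open>The specification of the planner speaks only of agents started in states of
    \<open>T\<close>, hence the need for \<open>q\<^sub>0 \<in> states T\<close>.\<close>
  with assms(5-7) have plan: "reactive_plan (agent_of T q\<^sub>0) RP"
    and sat: "plan_satisfies \<Pi> RP \<phi>"
    by (simp_all add: correct_planner_def)
  have "Out T q\<^sub>0 f\<^sub>R\<^sub>P \<subseteq> trajectories RP'"
    unfolding f using reactive_plan_simplification[OF simp plan]
      inj_on_label_simplification[OF simp plan] simplification_simps(1)[OF simp]
    by (intro Out_plan_strategy) auto
  also have "\<dots> \<subseteq> trajectories RP"
    by (rule trajectories_simplification[OF simp])
  finally show ?thesis
    using sat unfolding plan_satisfies_def by blast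
qed

end
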